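(* Let $X$ be a real or complex Banach space, let $A:\mathbb{N}\to\mathcal{B}(X)$ be a sequence, and consider the linear discrete-time system $x_{n+1}=A(n)x_n$ with associated operators $A_m^n$, $(m,n)\in\Delta$. The system is strongly exponentially stable if and only if there exist constants $D\ge1$, $d>0$ and $c\ge0$ with $0\le c<d$ such that $$\sum_{m=n}^{\infty}e^{d(m-n)}\|A_m^n x\|\le D e^{cn}\|x\|\quad\text{for all }n\in\mathbb{N}\text{ and }x\in X.$$
   Context: $\mathbb{N}=\{0,1,2,\dots\}$. $\mathcal{B}(X)$ is the Banach algebra of bounded linear operators on $X$, and $I$ is the identity operator. $\Delta$ is the set of pairs $(m,n)$ of nonnegative integers with $m\ge n$. $T$ is the set of triples $(m,n,p)$ of nonnegative integers with $(m,n)\in\Delta$ and $(n,p)\in\Delta$. For $(m,n)\in\Delta$, $A_m^n=A(m)A(m-1)\cdots A(n+1)$ if $m\ge n+1$, and $A_m^n=I$ if $m=n$. An inequality bounding an infinite series of nonnegative terms includes the assertion that the series converges. The system is strongly exponentially stable if there are constants $N\ge1$, $\alpha>0$ and $\beta\in[0,\alpha)$ such that $\|A_m^p x\|\le N e^{-\alpha(m-n)}e^{\beta n}\|A_n^p x\|$ for all $(m,n,p)\in T$ and $x\in X$. *)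

theory Defs
  imports "HOL-Analysis.Analysis"
begin

text \<open>
  Scalar multiplication of a normed space over the field \<open>'k\<close>. The class \<open>banach\<close> only knows
  scalar multiplication by reals; the locale adds multiplication by a normed extension field of the
  reals. Up to isometric isomorphism, the instances of \<open>real_normed_field\<close> are exactly the real and the
  complex numbers, and for \<open>'k = real\<close> the only possible \<open>smul\<close> is \<open>(*\<^sub>R)\<close>.
\<close>

locale normed_scalars = vector_space smul
  for smul :: "'k::real_normed_field \<Rightarrow> 'a::real_normed_vector \<Rightarrow> 'a" +
  assumes scale_of_real: "smul (of_real r) x = r *\<^sub>R x"
    and norm_scale: "norm (smul k x) = norm k * norm x"

lemma normed_scalars_real:
  "normed_scalars ((*\<^sub>R) :: real \<Rightarrow> 'a::real_normed_vector \<Rightarrow> 'a)"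
  by unfold_locales (auto simp: algebra_simps)

lemma normed_scalars_mult:
  "normed_scalars ((*) :: 'k::real_normed_field \<Rightarrow> 'k \<Rightarrow> 'k)"
  by unfold_locales (auto simp: algebra_simps norm_mult scaleR_conv_of_real)

text \<open>
  The type \<open>'a \<Rightarrow>\<^sub>L 'a\<close> consists of the bounded real-linear operators; linearity over \<open>'k\<close>
  has to be required separately.
\<close>

definition bounded_operators ::
    "('k::real_normed_field \<Rightarrow> 'a::real_normed_vector \<Rightarrow> 'a) \<Rightarrow> ('a \<Rightarrow>\<^sub>L 'a) set" where
  "bounded_operators smul =
     {B. \<forall>k x. blinfun_apply B (smul k x) = smul k (blinfun_apply B x)}"

lemma bounded_operators_real: "bounded_operators (*\<^sub>R) = UNIV"
  by (auto simp: bounded_operators_def blinfun.scaleR_right)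

text \<open>
  For \<open>m \<ge> n\<close>, \<open>evol A m n\<close> is the product \<open>A(m) A(m-1) \<cdots> A(n+1)\<close>; the values for \<open>m < n\<close> are
  irrelevant.
\<close>

primrec evol :: "(nat \<Rightarrow> 'a::real_normed_vector \<Rightarrow>\<^sub>L 'a) \<Rightarrow> nat \<Rightarrow> nat \<Rightarrow> 'a \<Rightarrow>\<^sub>L 'a" where
  "evol A 0 n = id_blinfun"
| "evol A (Suc m) n = (if n \<le> m then A (Suc m) o\<^sub>L evol A m n else id_blinfun)"

definition strongly_exp_stable :: "(nat \<Rightarrow> 'a::real_normed_vector \<Rightarrow>\<^sub>L 'a) \<Rightarrow> bool" where
  "strongly_exp_stable A \<longleftrightarrow>
     (\<exists>N \<alpha> \<beta> :: real. N \<ge> 1 \<and> \<alpha> > 0 \<and> 0 \<le> \<beta> \<and> \<beta> < \<alpha> \<and>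
        (\<forall>m n p x. n \<le> m \<longrightarrow> p \<le> n \<longrightarrow>
           norm (blinfun_apply (evol A m p) x)
             \<le> N * exp (- \<alpha> * (real m - real n)) * exp (\<beta> * real n) *
               norm (blinfun_apply (evol A n p) x)))"

end

theory Submission
  imports Defs
begin

text \<open>
  For the forward direction, take any \<open>d\<close> strictly between \<open>\<beta>\<close> and \<open>\<alpha>\<close> and compare with the geometric
  series of ratio \<open>exp (d - \<alpha>)\<close>. For the converse, each single term is bounded by the whole sum;
  evaluating the bound at \<open>A\<^sub>n\<^sup>p x\<close> gives stability with \<open>\<alpha> = d\<close> and \<open>\<beta> = c\<close>.
\<close>

lemma evol_same [simp]: "evol A n n = id_blinfun"
  by (cases n) auto

text \<open>Induction on \<open>m\<close> upward from \<open>n\<close>: each step puts one more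
  factor on the left of both sides, so associativity suffices. In the converse direction this
  identity turns a bound with two indices into one with the three indices of strong
  stability.\<close>

lemma evol_comp:
  assumes "p \<le> n" "n \<le> m"
  shows "evol A m n o\<^sub>L evol A n p = evol A m p"
  using assms(2)
proof (induction m rule: dec_induct)
  case base
  show ?case by (auto intro: blinfun_eqI)
next
  case (step m)
  have "evol A (Suc m) n o\<^sub>L evol A n p = A (Suc m) o\<^sub>L (evol A m n o\<^sub>L evol A n p)"
    using step.hyps by (auto intro: blinfun_eqI)
  also have "\<dots> = evol A (Suc m) p"
    using step.hyps assms(1) by (simp add: step.IH)
  finally show ?case .
qed

text \<open>The shift by \<open>n\<close> carries the usual geometric series to
  \<open>{n..}\<close>, where the truncated \<open>m - n\<close> inverts it. Nonnegative terms allow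
  the passage from \<open>sums\<close> to \<open>has_sum\<close>.\<close>

lemma has_sum_geometric_atLeast:
  fixes q C :: real
  assumes "0 \<le> q" "q < 1" "0 \<le> C"
  shows "((\<lambda>m. C * q ^ (m - n)) has_sum C / (1 - q)) {n..}"
proof -
  have "(\<lambda>k. C * q ^ k) sums (C * (1 / (1 - q)))"
    using assms by (intro sums_mult geometric_sums) simp
  then have "((\<lambda>k. C * q ^ k) has_sum C / (1 - q)) UNIV"
    using assms by (intro sums_nonneg_imp_has_sum) auto
  moreover have "bij_betw ((+) n) UNIV {n..}"
    by (rule bij_betw_byWitness[where f' = "\<lambda>m. m - n"]) auto
  ultimately show ?thesis
    using has_sum_reindex_bij_betw[of "(+) n" UNIV "{n..}" "\<lambda>m. C * q ^ (m - n)"] by simp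
qed

lemma le_infsum_nonneg:
  fixes f :: "'a \<Rightarrow> real"
  assumes "f summable_on S" "i \<in> S" "\<And>j. j \<in> S \<Longrightarrow> 0 \<le> f j"
  shows "f i \<le> infsum f S"
  using finite_sum_le_infsum[of f S "{i}"] assms by auto

theorem theorem10:
  fixes smul :: "'k::real_normed_field \<Rightarrow> 'a::banach \<Rightarrow> 'a"
    and A :: "nat \<Rightarrow> 'a \<Rightarrow>\<^sub>L 'a"
  assumes "normed_scalars smul"
    and "\<And>n. A n \<in> bounded_operators smul"
  shows "strongly_exp_stable A \<longleftrightarrow>
    (\<exists>D d c :: real. D \<ge> 1 \<and> d > 0 \<and> 0 \<le> c \<and> c < d \<and>
       (\<forall>n x. (\<lambda>m. exp (d * (real m - real n)) * norm (blinfun_apply (evol A m n) x))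
                 summable_on {n..} \<and>
          (\<Sum>\<^sub>\<infinity>m\<in>{n..}. exp (d * (real m - real n)) * norm (blinfun_apply (evol A m n) x))
            \<le> D * exp (c * real n) * norm x))"
proof
  let ?f = "\<lambda>d n x m. exp (d * (real m - real n)) * norm (blinfun_apply (evol A m n) x)"
  assume "strongly_exp_stable A"
  then obtain N \<alpha> \<beta> :: real where N: "N \<ge> 1" and "\<alpha> > 0" and \<beta>: "0 \<le> \<beta>" "\<beta> < \<alpha>"
    and bd: "\<And>m n p x. n \<le> m \<Longrightarrow> p \<le> n \<Longrightarrow> norm (blinfun_apply (evol A m p) x)
      \<le> N * exp (- \<alpha> * (real m - real n)) * exp (\<beta> * real n) * norm (blinfun_apply (evol A n p) x)"
    unfolding strongly_exp_stable_def by blast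
  obtain d where d: "\<beta> < d" "d < \<alpha>"
    using dense \<beta>(2) by blast
  define q where "q = exp (d - \<alpha>)"
  have q: "0 < q" "q < 1"
    using d by (auto simp: q_def)
  \<comment> \<open>The witness for \<open>D\<close>: the factor 1 / (1 - q) is the sum of the
    geometric series and exceeds 1. The witness for \<open>c\<close> will be \<beta>.\<close>
  have "1 \<le> N / (1 - q)"
    using N q by (simp add: field_simps)
  moreover have "?f d n x summable_on {n..} \<and>
      infsum (?f d n x) {n..} \<le> N / (1 - q) * exp (\<beta> * real n) * norm x" for n x
  proof -
    \<comment> \<open>The part of the majorant that is independent of \<open>m\<close>, so that
      \<open>C / (1 - q)\<close> is exactly the required bound.\<close>
    define C where "C = N * exp (\<beta> * real n) * norm x"
    have "0 \<le> C"
      using N by (simp add: C_def)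
    then have geom: "((\<lambda>m. C * q ^ (m - n)) has_sum C / (1 - q)) {n..}"
      using q by (intro has_sum_geometric_atLeast) auto
    have le: "?f d n x m \<le> C * q ^ (m - n)" if "m \<in> {n..}" for m
    proof -
      \<comment> \<open>As \<open>m\<close> is at least \<open>n\<close>, the natural difference in
        the exponent agrees with the real one; the power then splits into the weight of the series
        and the decay from stability.\<close>
      have "q ^ (m - n) = exp ((d - \<alpha>) * (real m - real n))"
        using that by (simp add: q_def exp_of_nat_mult [symmetric] of_nat_diff mult.commute)
      also have "\<dots> = exp (d * (real m - real n)) * exp (- \<alpha> * (real m - real n))"
        by (simp add: exp_add [symmetric] algebra_simps)
      finally have "C * q ^ (m - n) = exp (d * (real m - real n)) *
          (N * exp (- \<alpha> * (real m - real n)) * exp (\<beta> * real n) * norm x)"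
        by (simp add: C_def)
      \<comment> \<open>Stability with \<open>p = n\<close>, where \<open>evol A n n\<close> is the
        identity.\<close>
      moreover have "norm (blinfun_apply (evol A m n) x)
          \<le> N * exp (- \<alpha> * (real m - real n)) * exp (\<beta> * real n) * norm x"
        using bd[of n m n x] that by simp
      ultimately show ?thesis
        by simp
    qed
    \<comment> \<open>Convergence needs its own proof: \<open>infsum\<close> is 0 on a family that
      is not summable, so the bound alone would not give it.\<close>
    have summ: "?f d n x summable_on {n..}"
      by (rule summable_on_comparison_test[OF has_sum_imp_summable[OF geom]]) (use le in auto)
    have "infsum (?f d n x) {n..} \<le> C / (1 - q)"
      using has_sum_mono[OF has_sum_infsum[OF summ] geom le] .
    then show ?thesis
      using summ by (simp add: C_def)
  qed
  moreover have "0 < d"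
    using \<beta>(1) d(1) by linarith
  ultimately show "\<exists>D d c :: real. D \<ge> 1 \<and> d > 0 \<and> 0 \<le> c \<and> c < d \<and>
      (\<forall>n x. ?f d n x summable_on {n..} \<and>
        infsum (?f d n x) {n..} \<le> D * exp (c * real n) * norm x)"
    using \<beta>(1) d(1) by blast
next
  let ?f = "\<lambda>d n x m. exp (d * (real m - real n)) * norm (blinfun_apply (evol A m n) x)"
  assume "\<exists>D d c :: real. D \<ge> 1 \<and> d > 0 \<and> 0 \<le> c \<and> c < d \<and>
      (\<forall>n x. ?f d n x summable_on {n..} \<and>
        infsum (?f d n x) {n..} \<le> D * exp (c * real n) * norm x)"
  then obtain D d c :: real where D: "D \<ge> 1" "d > 0" "0 \<le> c" "c < d"
    and summ: "\<And>n x. ?f d n x summable_on {n..}"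
    and le: "\<And>n x. infsum (?f d n x) {n..} \<le> D * exp (c * real n) * norm x"
    by blast
  have "norm (blinfun_apply (evol A m p) x)
      \<le> D * exp (- d * (real m - real n)) * exp (c * real n) * norm (blinfun_apply (evol A n p) x)"
    if "n \<le> m" "p \<le> n" for m n p x
  proof -
    define y where "y = blinfun_apply (evol A n p) x"
    have "evol A m p = evol A m n o\<^sub>L evol A n p"
      by (rule evol_comp[OF that(2,1), symmetric])
    then have y: "blinfun_apply (evol A m p) x = blinfun_apply (evol A m n) y"
      by (simp add: y_def)
    have "?f d n y m \<le> infsum (?f d n y) {n..}"
      by (rule le_infsum_nonneg[OF summ]) (use that in auto)
    also note le[of n y]
    \<comment> \<open>Dividing by the positive weight \<open>exp (d * (real m - real n))\<close>
      turns it into the decay factor on the right.\<close>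
    finally show ?thesis
      unfolding y y_def [symmetric] by (simp add: exp_minus divide_simps mult_ac)
  qed
  with D show "strongly_exp_stable A"
    unfolding strongly_exp_stable_def by blast
qed

end
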